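(* Let $N\ge 2$ be the number of cells, with indices $i$ taken modulo $N$ (periodic boundary conditions), let $\delta t>0$ and $\delta x>0$ be the time and space steps, and consider a discrete traffic model $$\rho_i(t+\delta t)=\rho_i(t)+\frac{\delta t}{\delta x}\big(f_{i-1}(t)-f_i(t)\big)=:F\big(\rho_i(t),\rho_{i+1}(t),\rho_{i+2}(t),\rho_{i-1}(t)\big),$$ where the boundary flow $f_i(t)$ is a function of $\rho_i(t),\rho_{i+1}(t),\rho_{i+2}(t)$ (the same function for each $i$), differentiable at the equilibrium $(\rho_e,\rho_e,\rho_e)$. Let $$\alpha=\frac{\partial F}{\partial \rho_i},\qquad \beta=\frac{\partial F}{\partial \rho_{i+1}},\qquad \gamma=\frac{\partial F}{\partial \rho_{i+2}},\qquad \xi=\frac{\partial F}{\partial \rho_{i-1}}$$ be the partial derivatives of $F$ evaluated at $(\rho_e,\rho_e,\rho_e,\rho_e)$. Then the homogeneous configuration $\rho_i(t)=\rho_e$ for all $i$ and $t$ is linearly stable if and only if $$\alpha^2+\beta^2+\gamma^2+\xi^2-2\alpha\gamma-2\beta\xi+2f(c_l)<1\qquad\text{for all } l=1,\ldots,N-1,$$ where $c_l=\cos(2\pi l/N)$ and $$f(x)=(\alpha\beta+\alpha\xi+\beta\gamma-3\gamma\xi)\,x+2(\alpha\gamma+\beta\xi)\,x^2+4\gamma\xi\,x^3 .$$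
   Context: Linear stability: the perturbations are $\varepsilon_i(t)=\rho_i(t)-\rho_e$, and the linearised system on the ring of $N$ cells is $$\varepsilon_i(t+\delta t)=\alpha\,\varepsilon_i(t)+\beta\,\varepsilon_{i+1}(t)+\gamma\,\varepsilon_{i+2}(t)+\xi\,\varepsilon_{i-1}(t),\qquad i\in\mathbb{Z}/N\mathbb{Z}.$$ The scheme conserves the total mass $\sum_i\rho_i$. The homogeneous configuration is called linearly stable if every solution of the linearised system whose initial perturbation satisfies $\sum_{i}\varepsilon_i(0)=0$ tends to $0$ as the number of time steps tends to infinity. *)

theory Defs
  imports "HOL-Analysis.Analysis"
begin

text \<open>
  One time step of the conservative scheme. The flow \<open>g\<close> gives
  \<open>f\<^sub>i = g (\<rho>\<^sub>i, \<rho>\<^sub>i\<^sub>+\<^sub>1, \<rho>\<^sub>i\<^sub>+\<^sub>2)\<close>, and the four arguments \<open>a b c d\<close> are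
  \<open>\<rho>\<^sub>i\<close>, \<open>\<rho>\<^sub>i\<^sub>+\<^sub>1\<close>, \<open>\<rho>\<^sub>i\<^sub>+\<^sub>2\<close>, \<open>\<rho>\<^sub>i\<^sub>-\<^sub>1\<close> in this order, so that \<open>f\<^sub>i\<^sub>-\<^sub>1 = g (d, a, b)\<close>.
\<close>

definition scheme_update ::
  "real \<Rightarrow> real \<Rightarrow> (real \<times> real \<times> real \<Rightarrow> real) \<Rightarrow> real \<Rightarrow> real \<Rightarrow> real \<Rightarrow> real \<Rightarrow> real"
  where "scheme_update \<delta>t \<delta>x g a b c d = a + \<delta>t / \<delta>x * (g (d, a, b) - g (a, b, c))"

definition partial1 :: "(real \<Rightarrow> real \<Rightarrow> real \<Rightarrow> real \<Rightarrow> real) \<Rightarrow> real \<Rightarrow> real \<Rightarrow> real \<Rightarrow> real \<Rightarrow> real"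
  where "partial1 F a b c d = deriv (\<lambda>x. F x b c d) a"

definition partial2 :: "(real \<Rightarrow> real \<Rightarrow> real \<Rightarrow> real \<Rightarrow> real) \<Rightarrow> real \<Rightarrow> real \<Rightarrow> real \<Rightarrow> real \<Rightarrow> real"
  where "partial2 F a b c d = deriv (\<lambda>x. F a x c d) b"

definition partial3 :: "(real \<Rightarrow> real \<Rightarrow> real \<Rightarrow> real \<Rightarrow> real) \<Rightarrow> real \<Rightarrow> real \<Rightarrow> real \<Rightarrow> real \<Rightarrow> real"
  where "partial3 F a b c d = deriv (\<lambda>x. F a b x d) c"

definition partial4 :: "(real \<Rightarrow> real \<Rightarrow> real \<Rightarrow> real \<Rightarrow> real) \<Rightarrow> real \<Rightarrow> real \<Rightarrow> real \<Rightarrow> real \<Rightarrow> real"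
  where "partial4 F a b c d = deriv (\<lambda>x. F a b c x) d"

text \<open>
  Functions on \<open>\<int>/N\<int>\<close> are represented by \<open>N\<close>-periodic functions on the integers.
  The first argument of \<open>\<epsilon>\<close> counts time steps: \<open>\<epsilon> n i\<close> is the perturbation of cell \<open>i\<close>
  at time \<open>n \<delta>t\<close>.
\<close>

definition linearised_solution ::
  "nat \<Rightarrow> (real \<Rightarrow> real \<Rightarrow> real \<Rightarrow> real \<Rightarrow> real) \<Rightarrow> real \<Rightarrow> (nat \<Rightarrow> int \<Rightarrow> real) \<Rightarrow> bool"
  where "linearised_solution N F \<rho>e \<epsilon> \<longleftrightarrow>
    (\<forall>n i. \<epsilon> n (i + int N) = \<epsilon> n i) \<and>
    (\<forall>n i. \<epsilon> (Suc n) i =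
        partial1 F \<rho>e \<rho>e \<rho>e \<rho>e * \<epsilon> n i
      + partial2 F \<rho>e \<rho>e \<rho>e \<rho>e * \<epsilon> n (i + 1)
      + partial3 F \<rho>e \<rho>e \<rho>e \<rho>e * \<epsilon> n (i + 2)
      + partial4 F \<rho>e \<rho>e \<rho>e \<rho>e * \<epsilon> n (i - 1))"

text \<open>
  Only perturbations of zero total mass are tested: the scheme conserves mass, so a
  perturbation of nonzero mass cannot decay.
\<close>

definition linearly_stable ::
  "nat \<Rightarrow> (real \<Rightarrow> real \<Rightarrow> real \<Rightarrow> real \<Rightarrow> real) \<Rightarrow> real \<Rightarrow> bool"
  where "linearly_stable N F \<rho>e \<longleftrightarrow>
    (\<forall>\<epsilon>. linearised_solution N F \<rho>e \<epsilon> \<longrightarrow> (\<Sum>i\<in>{0..<int N}. \<epsilon> 0 i) = 0 \<longrightarrow>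
      (\<forall>i. (\<lambda>n. \<epsilon> n i) \<longlonglongrightarrow> 0))"

end

theory Submission
  imports Defs
begin

text \<open>
  The linearised system is a convolution on the cyclic group of order \<open>N\<close>, so the characters
  \<open>i \<mapsto> z powi i\<close>, one for each \<open>N\<close>-th root of unity \<open>z\<close>, diagonalise it: a time step multiplies
  the component along \<open>z\<close> by the amplification factor
  \<open>\<alpha> + \<beta> * z + \<gamma> * z ^ 2 + \<xi> / z\<close>.  Perturbations of zero mass are exactly those without a
  component along \<open>z = 1\<close>.  Stability therefore means that the factor has modulus less than \<open>1\<close> at
  every \<open>N\<close>-th root of unity \<open>z \<noteq> 1\<close> (\<open>linearly_stable_iff_amplification\<close>).  If it has, Fourier
  inversion (\<open>fourier_inversion\<close>) writes each perturbation as a finite sum of decaying modes; if it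
  fails at some \<open>z\<close>, the real or the imaginary part of that mode is a real solution of zero mass
  that does not decay.

  For \<open>z = cis t\<close> the squared modulus of the factor is a cubic polynomial in \<open>cos t\<close>
  (\<open>norm_amplification_cis\<close>), and the roots \<open>z \<noteq> 1\<close> are the points with \<open>t = 2 * pi * l / N\<close>,
  \<open>1 \<le> l \<le> N - 1\<close>; this turns the condition into the stated inequalities.
\<close>

section \<open>Fourier analysis of periodic sequences\<close>

text \<open>
  Translation invariance of the sum over one period is used below to compute how Fourier
  coefficients change under a shift and to see that nontrivial characters have mean zero.
\<close>

lemma sum_shift_periodic:
  fixes h :: "int \<Rightarrow> 'a::ab_group_add"
  assumes per: "\<And>i. h (i + int N) = h i"
  shows "(\<Sum>i\<in>{0..<int N}. h (i + m)) = (\<Sum>i\<in>{0..<int N}. h i)"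
proof -
  have step: "(\<Sum>i\<in>{0..<int N}. k (i + 1)) = (\<Sum>i\<in>{0..<int N}. k i)"
    if "\<And>i. k (i + int N) = k i" for k :: "int \<Rightarrow> 'a"
  proof (cases "N = 0")
    case False
    have "(\<Sum>i\<in>{0..<int N}. k (i + 1)) = (\<Sum>i\<in>{1..<int N + 1}. k i)"
      by (rule sum.reindex_bij_witness[of _ "\<lambda>i. i - 1" "\<lambda>i. i + 1"]) auto
    also have "{1..<int N + 1} = insert (int N) {1..<int N}"
      using False by auto
    also have "sum k \<dots> = k 0 + sum k {1..<int N}"
      using that[of 0] by simp
    also have "\<dots> = sum k (insert 0 {1..<int N})"
      by simp
    also have "insert 0 {1..<int N} = {0..<int N}"
      using False by auto
    finally show ?thesis .
  qed simp
  show ?thesis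
  proof (induction m rule: int_induct[where k = 0])
    case base
    show ?case by simp
  next
    case (step1 m)
    have "(\<Sum>i\<in>{0..<int N}. h ((i + 1) + m)) = (\<Sum>i\<in>{0..<int N}. h (i + m))"
      by (rule step[of "\<lambda>i. h (i + m)"]) (metis per add.commute add.left_commute)
    then show ?case
      using step1 by (simp add: add.assoc add.commute[of 1])
  next
    case (step2 m)
    have "(\<Sum>i\<in>{0..<int N}. h ((i + 1) + (m - 1))) = (\<Sum>i\<in>{0..<int N}. h (i + (m - 1)))"
      by (rule step[of "\<lambda>i. h (i + (m - 1))"]) (metis per add.commute add.left_commute)
    then show ?case
      using step2 by simp
  qed
qed

lemma root_unity_nonzero:
  fixes z :: complex
  assumes "N > 0" "z ^ N = 1"
  shows "z \<noteq> 0"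
  using assms by (auto simp: power_0_left)

lemma power_int_root_unity_periodic:
  fixes z :: complex
  assumes "N > 0" "z ^ N = 1"
  shows "z powi (i + int N) = z powi i"
  using assms root_unity_nonzero[OF assms] by (simp add: power_int_add)

text \<open>
  A shift by one cell multiplies the sum by \<open>z\<close> but cannot change it.  This makes the mode of
  \<open>z \<noteq> 1\<close> an admissible perturbation, of zero mass.
\<close>

lemma sum_power_int_root_unity:
  fixes z :: complex
  assumes "N > 0" "z ^ N = 1" "z \<noteq> 1"
  shows "(\<Sum>i\<in>{0..<int N}. z powi i) = 0"
proof -
  have "(\<Sum>i\<in>{0..<int N}. z powi i) = (\<Sum>i\<in>{0..<int N}. z powi (i + 1))"
    using power_int_root_unity_periodic[OF assms(1,2)]
    by (intro sum_shift_periodic[symmetric])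
  also have "\<dots> = z * (\<Sum>i\<in>{0..<int N}. z powi i)"
    using root_unity_nonzero[OF assms(1,2)]
    by (simp add: power_int_add sum_distrib_left mult.commute)
  finally show ?thesis
    using assms(3) by simp
qed

text \<open>
  The dual orthogonality relation: multiplication by a primitive root \<open>w\<close> permutes the \<open>N\<close>-th
  roots of unity and multiplies the sum by \<open>w powi m\<close>, which differs from \<open>1\<close>.
\<close>

lemma sum_roots_unity_power_int:
  assumes "N > 0" "\<not> int N dvd m"
  shows "(\<Sum>z | z ^ N = 1. (z::complex) powi m) = 0"
proof -
  define w where "w = cis (2 * pi / real N)"
  have w: "w ^ N = 1" "w \<noteq> 0"
    using assms(1) by (simp_all add: w_def Complex.DeMoivre)
  have "w powi m = cis (2 * pi * of_int m / real N)"
    by (simp add: w_def cis_power_int mult_ac)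
  moreover have "\<dots> \<noteq> 1"
  proof
    assume "cis (2 * pi * of_int m / real N) = 1"
    then have "cos (2 * pi * of_int m / real N) = 1"
      by (simp add: complex_eq_iff)
    then obtain k :: int where "2 * pi * of_int m / real N = of_int k * 2 * pi"
      by (auto simp: cos_one_2pi_int)
    then have "of_int m = (of_int (k * int N) :: real)"
      using assms(1) by (simp add: field_simps)
    then have "m = k * int N"
      by (simp only: of_int_eq_iff)
    with assms(2) show False by simp
  qed
  ultimately have ne: "w powi m \<noteq> 1" by simp
  have "(\<Sum>z | z ^ N = 1. z powi m) = (\<Sum>z | z ^ N = 1. (w * z) powi m)"
    by (rule sum.reindex_bij_witness[of _ "\<lambda>z. w * z" "\<lambda>z. z / w"])
      (use w in \<open>auto simp: power_divide power_mult_distrib\<close>)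
  also have "\<dots> = w powi m * (\<Sum>z | z ^ N = 1. z powi m)"
    by (simp add: power_int_mult_distrib sum_distrib_left)
  finally show ?thesis
    using ne by simp
qed

definition fourier_coeff :: "nat \<Rightarrow> (int \<Rightarrow> complex) \<Rightarrow> complex \<Rightarrow> complex"
  where "fourier_coeff N u z = (\<Sum>i\<in>{0..<int N}. u i * z powi (- i))"

lemma fourier_coeff_shift:
  assumes "N > 0" "z ^ N = 1" "\<And>i. u (i + int N) = u i"
  shows "fourier_coeff N (\<lambda>i. u (i + m)) z = z powi m * fourier_coeff N u z"
proof -
  have nz: "z \<noteq> 0"
    by (rule root_unity_nonzero[OF assms(1,2)])
  have per: "u (i + int N) * z powi (- (i + int N)) = u i * z powi (- i)" for i
    using power_int_root_unity_periodic[OF assms(1,2), of "- (i + int N)"] assms(3) by simp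
  have "z powi m * fourier_coeff N u z
      = z powi m * (\<Sum>i\<in>{0..<int N}. u (i + m) * z powi (- (i + m)))"
    unfolding fourier_coeff_def
    by (simp only: sum_shift_periodic[of "\<lambda>i. u i * z powi (- i)", OF per])
  also have "\<dots> = fourier_coeff N (\<lambda>i. u (i + m)) z"
    unfolding fourier_coeff_def sum_distrib_left
    using nz by (intro sum.cong) (auto simp: power_int_diff power_int_minus field_simps)
  finally show ?thesis ..
qed

text \<open>
  Shifting by \<open>j\<close> reduces the claim to the value at cell \<open>0\<close>.  There, after exchanging the two sums,
  orthogonality keeps only \<open>i = 0\<close>, the one multiple of \<open>N\<close> in the period \<open>{0..<N}\<close>.
\<close>

lemma fourier_inversion:
  assumes "N > 0" "\<And>i. u (i + int N) = u i"
  shows "of_nat N * u j = (\<Sum>z | z ^ N = 1. z powi j * fourier_coeff N u z)"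
proof -
  have orth: "(\<Sum>z | z ^ N = 1. (z::complex) powi (- i)) = (if i = 0 then of_nat N else 0)"
    if "i \<in> {0..<int N}" for i
  proof (cases "i = 0")
    case True
    then show ?thesis
      using card_roots_unity_eq[of N] assms(1) by simp
  next
    case False
    then have "\<not> int N dvd - i"
      using that zdvd_imp_le by fastforce
    then show ?thesis
      using sum_roots_unity_power_int[OF assms(1)] False by simp
  qed
  have "(\<Sum>z | z ^ N = 1. z powi j * fourier_coeff N u z)
      = (\<Sum>z | z ^ N = 1. fourier_coeff N (\<lambda>i. u (i + j)) z)"
    using assms by (intro sum.cong) (simp_all add: fourier_coeff_shift)
  also have "\<dots> = (\<Sum>i\<in>{0..<int N}. u (i + j) * (\<Sum>z | z ^ N = 1. z powi (- i)))"
    unfolding fourier_coeff_def sum_distrib_left by (rule sum.swap)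
  also have "\<dots> = (\<Sum>i\<in>{0..<int N}. if i = 0 then of_nat N * u j else 0)"
    by (intro sum.cong refl) (auto simp: orth)
  also have "\<dots> = of_nat N * u j"
    using assms(1) by simp
  finally show ?thesis ..
qed

section \<open>The amplification factor\<close>

text \<open>
  The eigenvalue of one time step on the mode \<open>i \<mapsto> z powi i\<close>: a look-ahead by \<open>k\<close> cells contributes
  \<open>z powi k\<close>.  The coefficients belong to the cells \<open>i\<close>, \<open>i + 1\<close>, \<open>i + 2\<close>, \<open>i - 1\<close>, in this order.
\<close>

definition amplification :: "real \<Rightarrow> real \<Rightarrow> real \<Rightarrow> real \<Rightarrow> complex \<Rightarrow> complex"
  where "amplification a b c d z
    = of_real a + of_real b * z + of_real c * z ^ 2 + of_real d * inverse z"

text \<open>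
  The double and triple angles in the squared modulus disappear once real and imaginary part are
  written in \<open>x = cos t\<close> and \<open>y = sin t\<close>: the imaginary part has the factor \<open>y\<close>, and
  \<open>y\<^sup>2 = 1 - x\<^sup>2\<close> leaves a polynomial identity in \<open>x\<close>.
\<close>

lemma norm_amplification_cis:
  fixes a b c d t :: real
  shows "(norm (amplification a b c d (cis t)))\<^sup>2
    = a ^ 2 + b ^ 2 + c ^ 2 + d ^ 2 - 2 * a * c - 2 * b * d
      + 2 * ((a * b + a * d + b * c - 3 * c * d) * cos t
             + 2 * (a * c + b * d) * cos t ^ 2 + 4 * c * d * cos t ^ 3)"
proof -
  define x y where "x = cos t" and "y = sin t"
  have y2: "y\<^sup>2 = 1 - x\<^sup>2"
    by (simp add: x_def y_def sin_squared_eq)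
  have Re: "Re (amplification a b c d (cis t)) = a + b * x + c * (2 * x\<^sup>2 - 1) + d * x"
    using y2 by (simp add: amplification_def power2_eq_square x_def y_def)
  have Im: "Im (amplification a b c d (cis t)) = y * (b + 2 * c * x - d)"
    by (simp add: amplification_def power2_eq_square x_def y_def algebra_simps)
  have "(norm (amplification a b c d (cis t)))\<^sup>2
      = (a + b * x + c * (2 * x\<^sup>2 - 1) + d * x)\<^sup>2 + (1 - x\<^sup>2) * (b + 2 * c * x - d)\<^sup>2"
    by (simp add: cmod_power2 Re Im power_mult_distrib y2)
  also have "\<dots> = a ^ 2 + b ^ 2 + c ^ 2 + d ^ 2 - 2 * a * c - 2 * b * d
      + 2 * ((a * b + a * d + b * c - 3 * c * d) * x
             + 2 * (a * c + b * d) * x ^ 2 + 4 * c * d * x ^ 3)"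
    by algebra
  finally show ?thesis
    by (simp add: x_def)
qed

text \<open>Shifts act on the coefficient at \<open>z\<close> by powers of \<open>z\<close>, so the four terms add up to one factor.\<close>

lemma fourier_coeff_step:
  assumes "N > 0" "z ^ N = 1" "\<And>i. u (i + int N) = u i"
    and v: "\<And>i. v i = of_real a * u i + of_real b * u (i + 1)
                 + of_real c * u (i + 2) + of_real d * u (i - 1)"
  shows "fourier_coeff N v z = amplification a b c d z * fourier_coeff N u z"
proof -
  have "fourier_coeff N v z
      = of_real a * fourier_coeff N u z + of_real b * fourier_coeff N (\<lambda>i. u (i + 1)) z
      + of_real c * fourier_coeff N (\<lambda>i. u (i + 2)) z
      + of_real d * fourier_coeff N (\<lambda>i. u (i + - 1)) z"
    by (simp add: fourier_coeff_def v sum.distrib sum_distrib_left algebra_simps)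
  also have "\<dots> = amplification a b c d z * fourier_coeff N u z"
    unfolding fourier_coeff_shift[of N z u, OF assms(1-3)] amplification_def
    by (simp add: power_int_minus algebra_simps)
  finally show ?thesis .
qed

section \<open>Stability in terms of the modes\<close>

text \<open>
  The von Neumann criterion.  The trivial mode \<open>z = 1\<close> is excluded because its coefficient is the
  total mass, which vanishes initially and hence at all times.
\<close>

lemma linearly_stable_iff_amplification:
  fixes F :: "real \<Rightarrow> real \<Rightarrow> real \<Rightarrow> real \<Rightarrow> real" and r :: real
  assumes "N > 0"
  defines "A \<equiv> amplification (partial1 F r r r r) (partial2 F r r r r)
                             (partial3 F r r r r) (partial4 F r r r r)"
  shows "linearly_stable N F r \<longleftrightarrow> (\<forall>z. z ^ N = 1 \<and> z \<noteq> 1 \<longrightarrow> norm (A z) < 1)"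
proof
  assume stable: "linearly_stable N F r"
  show "\<forall>z. z ^ N = 1 \<and> z \<noteq> 1 \<longrightarrow> norm (A z) < 1"
  proof (intro allI impI, elim conjE)
    fix z :: complex
    assume z: "z ^ N = 1" "z \<noteq> 1"
    have nz: "z \<noteq> 0"
      by (rule root_unity_nonzero[OF assms(1) z(1)])
    define u where "u n i = A z ^ n * z powi i" for n i
    have per: "u n (i + int N) = u n i" for n i
      by (simp only: u_def power_int_root_unity_periodic[OF assms(1) z(1)])
    have step: "u (Suc n) i = of_real (partial1 F r r r r) * u n i
        + of_real (partial2 F r r r r) * u n (i + 1)
        + of_real (partial3 F r r r r) * u n (i + 2)
        + of_real (partial4 F r r r r) * u n (i - 1)" for n i
      using nz by (simp add: u_def A_def amplification_def power_int_add power_int_diff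
          divide_inverse algebra_simps)
    have mass: "(\<Sum>i\<in>{0..<int N}. u 0 i) = 0"
      by (simp add: u_def sum_power_int_root_unity[OF assms(1) z])
    \<comment> \<open>Only real perturbations are tested, so the two parts of the mode are used separately.\<close>
    have "linearised_solution N F r (\<lambda>n i. Re (u n i))"
      unfolding linearised_solution_def by (simp only: per step) simp
    moreover have "(\<Sum>i\<in>{0..<int N}. Re (u 0 i)) = 0"
      using mass by (simp flip: Re_sum)
    ultimately have re: "(\<lambda>n. Re (u n 0)) \<longlonglongrightarrow> 0"
      using stable unfolding linearly_stable_def by blast
    have "linearised_solution N F r (\<lambda>n i. Im (u n i))"
      unfolding linearised_solution_def by (simp only: per step) simp
    moreover have "(\<Sum>i\<in>{0..<int N}. Im (u 0 i)) = 0"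
      using mass by (simp flip: Im_sum)
    ultimately have im: "(\<lambda>n. Im (u n 0)) \<longlonglongrightarrow> 0"
      using stable unfolding linearly_stable_def by blast
    have "(\<lambda>n. A z ^ n) \<longlonglongrightarrow> 0"
      using re im by (simp add: tendsto_complex_iff u_def)
    then have "(\<lambda>n. norm (A z ^ n)) \<longlonglongrightarrow> 0"
      by (rule tendsto_norm_zero)
    then have "\<forall>\<^sub>F n in sequentially. norm (A z ^ n) < 1"
      by (rule order_tendstoD(2)) (rule zero_less_one)
    then obtain n where "norm (A z) ^ n < 1"
      unfolding eventually_sequentially norm_power by blast
    then show "norm (A z) < 1"
      using one_le_power[of "norm (A z)" n] by linarith
  qed
next
  assume contr: "\<forall>z. z ^ N = 1 \<and> z \<noteq> 1 \<longrightarrow> norm (A z) < 1"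
  show "linearly_stable N F r"
    unfolding linearly_stable_def
  proof (intro allI impI)
    fix \<epsilon> :: "nat \<Rightarrow> int \<Rightarrow> real" and j :: int
    assume sol: "linearised_solution N F r \<epsilon>" and mass: "(\<Sum>i\<in>{0..<int N}. \<epsilon> 0 i) = 0"
    define u where "u n i = complex_of_real (\<epsilon> n i)" for n i
    have per: "u n (i + int N) = u n i" for n i
      using sol by (simp add: linearised_solution_def u_def)
    define C where "C = fourier_coeff N (u 0)"
    have coeff: "fourier_coeff N (u n) z = A z ^ n * C z"
      if "z ^ N = 1" for n z
    proof (induction n)
      case (Suc n)
      have "fourier_coeff N (u (Suc n)) z = A z * fourier_coeff N (u n) z"
        unfolding A_def using sol
        by (intro fourier_coeff_step assms that per) (simp add: linearised_solution_def u_def)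
      then show ?case
        using Suc by simp
    qed (simp add: C_def)
    have "(\<lambda>n. z powi j * fourier_coeff N (u n) z) \<longlonglongrightarrow> 0" if z: "z ^ N = 1" for z
    proof (cases "z = 1")
      case True
      have "C 1 = 0"
        using mass by (simp add: C_def fourier_coeff_def u_def flip: of_real_sum)
      then show ?thesis
        unfolding coeff[OF z] using True by simp
    next
      case False
      then have "(\<lambda>n. A z ^ n) \<longlonglongrightarrow> 0"
        using contr z by (intro LIMSEQ_power_zero) blast
      then show ?thesis
        unfolding coeff[OF z] by (intro tendsto_mult_right_zero tendsto_mult_left_zero)
    qed
    then have "(\<lambda>n. \<Sum>z | z ^ N = 1. z powi j * fourier_coeff N (u n) z) \<longlonglongrightarrow> 0"
      by (intro tendsto_null_sum) auto
    then have "(\<lambda>n. of_nat N * u n j) \<longlonglongrightarrow> 0"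
      by (simp only: fourier_inversion[of N "u n" j for n, OF assms(1) per])
    then have "(\<lambda>n. of_nat N * u n j / of_nat N) \<longlonglongrightarrow> 0"
      by (rule tendsto_divide_zero)
    then have "(\<lambda>n. u n j) \<longlonglongrightarrow> 0"
      using assms(1) by simp
    then have "(\<lambda>n. Re (u n j)) \<longlonglongrightarrow> Re 0"
      by (rule tendsto_Re)
    then show "(\<lambda>n. \<epsilon> n j) \<longlonglongrightarrow> 0"
      by (simp add: u_def)
  qed
qed

theorem proposition3p2:
  fixes N :: nat
    and \<delta>t \<delta>x \<rho>e \<alpha> \<beta> \<gamma> \<xi> :: real
    and g :: "real \<times> real \<times> real \<Rightarrow> real"
    and F :: "real \<Rightarrow> real \<Rightarrow> real \<Rightarrow> real \<Rightarrow> real"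
    and f :: "real \<Rightarrow> real"
  assumes "N \<ge> 2" and "\<delta>t > 0" and "\<delta>x > 0"
    and "g differentiable (at (\<rho>e, \<rho>e, \<rho>e))"
    and "F = scheme_update \<delta>t \<delta>x g"
    and "\<alpha> = partial1 F \<rho>e \<rho>e \<rho>e \<rho>e"
    and "\<beta> = partial2 F \<rho>e \<rho>e \<rho>e \<rho>e"
    and "\<gamma> = partial3 F \<rho>e \<rho>e \<rho>e \<rho>e"
    and "\<xi> = partial4 F \<rho>e \<rho>e \<rho>e \<rho>e"
    and "f = (\<lambda>x. (\<alpha> * \<beta> + \<alpha> * \<xi> + \<beta> * \<gamma> - 3 * \<gamma> * \<xi>) * x
                  + 2 * (\<alpha> * \<gamma> + \<beta> * \<xi>) * x ^ 2 + 4 * \<gamma> * \<xi> * x ^ 3)"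
  shows "linearly_stable N F \<rho>e \<longleftrightarrow>
    (\<forall>l\<in>{1..N - 1}.
      \<alpha> ^ 2 + \<beta> ^ 2 + \<gamma> ^ 2 + \<xi> ^ 2 - 2 * \<alpha> * \<gamma> - 2 * \<beta> * \<xi>
        + 2 * f (cos (2 * pi * real l / real N)) < 1)"
proof -
  let ?w = "\<lambda>l. cis (2 * pi * real l / real N)"
  have N: "N > 0"
    using assms(1) by simp
  have bij: "bij_betw ?w {..<N} {z. z ^ N = 1}"
    by (rule Complex.bij_betw_roots_unity[OF N])
  have "bij_betw ?w ({..<N} - {0}) ({z. z ^ N = 1} - {1})"
    by (rule bij_betw_DiffI[OF bij]) (use N in \<open>auto simp: bij_betw_def\<close>)
  moreover have "{..<N} - {0} = {1..N - 1}"
    using N by auto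
  ultimately have roots: "{z. z ^ N = 1} - {1} = ?w ` {1..N - 1}"
    by (simp add: bij_betw_def)
  have "linearly_stable N F \<rho>e \<longleftrightarrow>
      (\<forall>z\<in>{z. z ^ N = 1} - {1}. norm (amplification \<alpha> \<beta> \<gamma> \<xi> z) < 1)"
    unfolding linearly_stable_iff_amplification[OF N] assms(6-9) by auto
  also have "\<dots> \<longleftrightarrow> (\<forall>l\<in>{1..N - 1}. (norm (amplification \<alpha> \<beta> \<gamma> \<xi> (?w l)))\<^sup>2 < 1)"
    unfolding roots by (simp add: power_less_one_iff abs_square_less_1)
  finally show ?thesis
    unfolding norm_amplification_cis assms(10) .
qed

end
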